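(* Let $G$ be a finite simple graph of order $n\ge 2$, let $S\subseteq V(G)$, and let $L(G_S)$ be the line graph of the self-loop graph $G_S$. Then every eigenvalue $\lambda$ of (the adjacency matrix of) $L(G_S)$ satisfies $\lambda\geq -2$.
   Context: For a simple graph $G$ and $S\subseteq V(G)$, $|S|=\sigma$, the self-loop graph $G_S$ is obtained from $G$ by attaching one loop at each vertex of $S$; let $m$ be the number of ordinary (non-loop) edges. The line graph $L(G)$ of a simple graph $G$ has the edges of $G$ as vertices, two being adjacent whenever they have exactly one vertex in common. The line graph $L(G_S)$ of $G_S$ has as vertices the $m$ edges and the $\sigma$ loops of $G_S$; two (distinct) ordinary edges are adjacent whenever they have exactly one vertex in common; each loop of $G_S$ attached at a vertex $v$ is a vertex of $L(G_S)$ which itself carries a loop and is adjacent to exactly those vertices of $L(G_S)$ that correspond to the ordinary edges of $G$ incident with $v$ (distinct loops are not adjacent to each other). Thus its adjacency matrix, of order $m+\sigma$, is $$A(L(G_S))=\begin{pmatrix} A(L(G)) & M^T\\ M & I_\sigma\end{pmatrix},$$ where $M=(m_{ij})_{\sigma\times m}$ has $m_{ij}=1$ if the vertex carrying the $i$-th loop is an endpoint of the $j$-th edge, and $m_{ij}=0$ otherwise. *)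

theory Defs
  imports "Jordan_Normal_Form.Char_Poly"
begin

text \<open>Undirected graphs without multiple edges in which loops are allowed. An edge is the set of its
  end points, so an ordinary edge is a two-element set and the loop at \<open>v\<close> is the singleton \<open>{v}\<close>.\<close>

record 'a loop_graph =
  verts :: "'a set"
  edges :: "'a set set"

definition simple_graph :: "'a loop_graph \<Rightarrow> bool" where
  "simple_graph G \<longleftrightarrow> finite (verts G) \<and> (\<forall>e\<in>edges G. e \<subseteq> verts G \<and> card e = 2)"

definition ordinary_edges :: "'a loop_graph \<Rightarrow> 'a set set" where
  "ordinary_edges G = {e \<in> edges G. card e = 2}"

definition loops :: "'a loop_graph \<Rightarrow> 'a set set" where
  "loops G = {l \<in> edges G. card l = 1}"

definition self_loop_graph :: "'a loop_graph \<Rightarrow> 'a set \<Rightarrow> 'a loop_graph" where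
  "self_loop_graph G S = \<lparr>verts = verts G, edges = edges G \<union> {{v} | v. v \<in> S}\<rparr>"

text \<open>On a simple graph this is the usual line graph: there are no loops and only the first of the
  three sets of edges is present. For graphs with loops, the third set puts a loop at every
  vertex that comes from a loop.\<close>

definition line_graph :: "'a loop_graph \<Rightarrow> 'a set loop_graph" where
  "line_graph G =
    \<lparr>verts = ordinary_edges G \<union> loops G,
     edges = {{e, f} | e f. e \<in> ordinary_edges G \<and> f \<in> ordinary_edges G \<and> e \<noteq> f \<and> card (e \<inter> f) = 1}
           \<union> {{l, e} | l e. l \<in> loops G \<and> e \<in> ordinary_edges G \<and> l \<subseteq> e}
           \<union> {{l} | l. l \<in> loops G}\<rparr>"

text \<open>The list enumerates the vertices, without repetition. A loop contributes 1 to the diagonal.\<close>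

definition adjacency_matrix :: "'a list \<Rightarrow> 'a loop_graph \<Rightarrow> real mat" where
  "adjacency_matrix vs G =
    mat (length vs) (length vs) (\<lambda>(i, j). if {vs ! i, vs ! j} \<in> edges G then 1 else 0)"

definition loop_incidence_matrix :: "'a list \<Rightarrow> 'a set list \<Rightarrow> real mat" where
  "loop_incidence_matrix ss es =
    mat (length ss) (length es) (\<lambda>(i, j). if ss ! i \<in> es ! j then 1 else 0)"

lemma doubleton_in_edges_line_graph_iff:
  "{x, y} \<in> edges (line_graph G) \<longleftrightarrow>
    x \<in> ordinary_edges G \<and> y \<in> ordinary_edges G \<and> x \<noteq> y \<and> card (x \<inter> y) = 1 \<or>
    x \<in> loops G \<and> y \<in> ordinary_edges G \<and> x \<subseteq> y \<or>
    y \<in> loops G \<and> x \<in> ordinary_edges G \<and> y \<subseteq> x \<or>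
    x = y \<and> x \<in> loops G"
proof -
  have 1: "{x, y} \<in> {{e, f} | e f. e \<in> A \<and> f \<in> A \<and> e \<noteq> f \<and> card (e \<inter> f) = 1} \<longleftrightarrow>
      x \<in> A \<and> y \<in> A \<and> x \<noteq> y \<and> card (x \<inter> y) = 1" for A
    by (auto simp: doubleton_eq_iff Int_commute)
  have 2: "{x, y} \<in> {{l, e} | l e. l \<in> B \<and> e \<in> A \<and> l \<subseteq> e} \<longleftrightarrow>
      x \<in> B \<and> y \<in> A \<and> x \<subseteq> y \<or> y \<in> B \<and> x \<in> A \<and> y \<subseteq> x" for A B
    unfolding mem_Collect_eq doubleton_eq_iff by blast
  have 3: "{x, y} \<in> {{l} | l. l \<in> B} \<longleftrightarrow> x = y \<and> x \<in> B" for B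
    unfolding mem_Collect_eq by blast
  show ?thesis
    unfolding line_graph_def loop_graph.simps Un_iff 1 2 3 by blast
qed

lemma adjacency_matrix_line_graph_self_loop_graph:
  assumes G: "simple_graph G" and es: "set es = edges G" and ss: "set ss = S"
    and dist: "distinct es" "distinct ss"
  shows "adjacency_matrix (es @ map (\<lambda>v. {v}) ss) (line_graph (self_loop_graph G S)) =
    four_block_mat (adjacency_matrix es (line_graph G))
      (transpose_mat (loop_incidence_matrix ss es))
      (loop_incidence_matrix ss es) (1\<^sub>m (length ss))"
proof -
  let ?H = "self_loop_graph G S"
  have c2: "card e = 2" if "e \<in> edges G" for e
    using G that by (auto simp: simple_graph_def)
  have oG: "ordinary_edges G = edges G" and lG: "loops G = {}"
    using c2 by (force simp: ordinary_edges_def loops_def)+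
  have oH: "ordinary_edges ?H = edges G" and lH: "loops ?H = {{v} | v. v \<in> S}"
    using c2 by (force simp: ordinary_edges_def loops_def self_loop_graph_def)+
  have ns: "{v} \<notin> edges G" for v
    using c2[of "{v}"] by auto
  note iff = doubleton_in_edges_line_graph_iff oG lG oH lH
  have sing: "{v} \<in> {{v} | v. v \<in> S}" if "v \<in> S" for v
    using that by blast
  have nl: "e \<notin> {{v} | v. v \<in> S}" if "e \<in> edges G" for e
    using that ns by blast
  have ee: "{e, f} \<in> edges (line_graph ?H) \<longleftrightarrow> {e, f} \<in> edges (line_graph G)"
    if "e \<in> edges G" "f \<in> edges G" for e f
    unfolding iff using that nl by blast
  have le: "{{v}, e} \<in> edges (line_graph ?H) \<longleftrightarrow> v \<in> e"
    if "v \<in> S" "e \<in> edges G" for v e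
    unfolding iff using that nl[OF that(2)] sing[OF that(1)] ns[of v] by blast
  have el: "{e, {v}} \<in> edges (line_graph ?H) \<longleftrightarrow> v \<in> e"
    if "v \<in> S" "e \<in> edges G" for v e
    using le[OF that] by (simp only: insert_commute[of e])
  have ll: "{{v}, {w}} \<in> edges (line_graph ?H) \<longleftrightarrow> v = w"
    if "v \<in> S" "w \<in> S" for v w
    using that ns by (simp add: iff)
  have [simp]: "es ! i \<in> edges G" if "i < length es" for i
    using nth_mem[OF that] by (simp only: es)
  have [simp]: "ss ! i \<in> S" if "i < length ss" for i
    using nth_mem[OF that] by (simp only: ss)
  show ?thesis (is "?A = ?B")
  proof (rule eq_matI)
    fix i j
    assume "i < dim_row ?B" "j < dim_col ?B"
    then have ij: "i < length es + length ss" "j < length es + length ss"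
      by (simp_all add: adjacency_matrix_def)
    show "?A $$ (i, j) = ?B $$ (i, j)"
    proof (cases "i < length es"; cases "j < length es")
      assume "i < length es" "j < length es"
      then show ?thesis
        by (simp add: adjacency_matrix_def nth_append ee)
    next
      assume "i < length es" "\<not> j < length es"
      then show ?thesis using ij
        by (simp add: adjacency_matrix_def loop_incidence_matrix_def nth_append el)
    next
      assume "\<not> i < length es" "j < length es"
      then show ?thesis using ij
        by (simp add: adjacency_matrix_def loop_incidence_matrix_def nth_append le)
    next
      assume *: "\<not> i < length es" "\<not> j < length es"
      then have "ss ! (i - length es) = ss ! (j - length es) \<longleftrightarrow> i - length es = j - length es"
        using ij by (intro nth_eq_iff_index_eq dist) simp_all
      then show ?thesis using * ij
        by (simp add: adjacency_matrix_def nth_append ll)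
    qed
  qed (simp_all add: adjacency_matrix_def)
qed

end

theory Submission
  imports Defs
begin

text \<open>Let \<open>B\<close> be the incidence matrix whose columns are the characteristic vectors of the ordinary
  edges and of the loops, and let \<open>D\<close> be the diagonal 0-1 matrix that marks the loops. Then
  \<open>A + 2 I = B\<^sup>T B + 2 D\<close>, which is positive semidefinite.\<close>

lemma eigenvalue_ge_if_quadratic_form_ge:
  fixes A :: "real mat"
  assumes A: "A \<in> carrier_mat n n" and ev: "eigenvalue A k"
    and ge: "\<And>x. c * (\<Sum>i<n. (x i)\<^sup>2) \<le> (\<Sum>i<n. \<Sum>j<n. A $$ (i, j) * x i * x j)"
  shows "c \<le> k"
proof -
  obtain v where v: "v \<in> carrier_vec n" "v \<noteq> 0\<^sub>v n" and eq: "A *\<^sub>v v = k \<cdot>\<^sub>v v"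
    using ev A by (auto simp: eigenvalue_def eigenvector_def)
  have row: "(\<Sum>j<n. A $$ (i, j) * v $ j) = k * v $ i" if "i < n" for i
    using arg_cong[OF eq, of "\<lambda>w. w $ i"] that A v
    by (simp add: scalar_prod_def atLeast0LessThan)
  \<comment> \<open>Pairing \<open>A v = k v\<close> with \<open>v\<close> turns the quadratic form
    at \<open>v\<close> into \<open>k\<close> times the squared norm of \<open>v\<close>. That norm
    is positive, so the hypothesis at \<open>x = v\<close> can be divided by it.\<close>
  have "(\<Sum>i<n. \<Sum>j<n. A $$ (i, j) * v $ i * v $ j) = (\<Sum>i<n. v $ i * (\<Sum>j<n. A $$ (i, j) * v $ j))"
    by (simp add: sum_distrib_left algebra_simps)
  also have "\<dots> = k * (\<Sum>i<n. (v $ i)\<^sup>2)"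
    unfolding sum_distrib_left[of k] by (intro sum.cong refl) (simp add: row power2_eq_square)
  finally have le: "c * (\<Sum>i<n. (v $ i)\<^sup>2) \<le> k * (\<Sum>i<n. (v $ i)\<^sup>2)"
    using ge[of "\<lambda>i. v $ i"] by simp
  obtain i where i: "i < n" "v $ i \<noteq> 0"
    using v by (metis carrier_vecD eq_vecI index_zero_vec)
  have "0 < (\<Sum>i<n. (v $ i)\<^sup>2)"
    using i by (intro sum_pos2[of _ i]) auto
  with le show ?thesis
    by simp
qed

text \<open>Entrywise form of \<open>A = B\<^sup>T B + 2 D - 2 I\<close>, since the entry of
  \<open>B\<^sup>T B\<close> at \<open>e\<close>, \<open>f\<close> is the size of
  \<open>e \<inter> f\<close>. Off the diagonal that size is already the adjacency indicator. On the
  diagonal an ordinary edge has size 2 but entry 0, so 2 is subtracted; a loop has size 1 and entry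
  1, so its corrections cancel.\<close>

lemma adjacency_line_graph_eq_card_Int:
  assumes e: "e \<in> ordinary_edges H \<union> loops H" and f: "f \<in> ordinary_edges H \<union> loops H"
  shows "(if {e, f} \<in> edges (line_graph H) then 1 else 0 :: real) =
    real (card (e \<inter> f)) + (if e = f then (if e \<in> loops H then 2 else 0) - 2 else 0)"
proof -
  have disj: "ordinary_edges H \<inter> loops H = {}"
    by (auto simp: ordinary_edges_def loops_def)
  have c2: "card x = 2" if "x \<in> ordinary_edges H" for x
    using that by (simp add: ordinary_edges_def)
  have c1: "\<exists>v. x = {v}" if "x \<in> loops H" for x
    using that by (simp add: loops_def card_1_singleton_iff)
  \<comment> \<open>Distinct two-element sets share at most one point, so the size of their
    intersection is 0 or 1, as an adjacency entry must be.\<close>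
  have lt: "card (x \<inter> y) < 2" if "x \<in> ordinary_edges H" "y \<in> ordinary_edges H" "x \<noteq> y" for x y
  proof -
    have fin: "finite x" "finite y"
      using c2 that by (metis card.infinite zero_neq_numeral)+
    have "x \<inter> y \<subset> x"
      using that fin c2 by (metis card_subset_eq inf.cobounded1 inf.cobounded2 psubsetI)
    then show ?thesis
      using psubset_card_mono[OF fin(1)] c2 that by metis
  qed
  note iff = doubleton_in_edges_line_graph_iff
  from e f consider "e \<in> ordinary_edges H" "f \<in> ordinary_edges H"
    | "e \<in> ordinary_edges H" "f \<in> loops H" | "e \<in> loops H" "f \<in> ordinary_edges H"
    | "e \<in> loops H" "f \<in> loops H"
    by blast
  then show ?thesis
  proof cases
    case 1
    then have "e \<notin> loops H" "f \<notin> loops H"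
      using disj by blast+
    then show ?thesis
      using 1 c2 lt[of e f] unfolding iff by (cases "e = f") auto
  next
    case 2
    then have "e \<notin> loops H" "f \<notin> ordinary_edges H"
      using disj by blast+
    then show ?thesis
      using 2 c1[of f] unfolding iff by auto
  next
    case 3
    then have "f \<notin> loops H" "e \<notin> ordinary_edges H"
      using disj by blast+
    then show ?thesis
      using 3 c1[of e] unfolding iff by auto
  next
    case 4
    then have "e \<notin> ordinary_edges H" "f \<notin> ordinary_edges H"
      using disj by blast+
    then show ?thesis
      using 4 c1[of e] c1[of f] unfolding iff by auto
  qed
qed

text \<open>The sizes of the intersections form the Gram matrix of the characteristic vectors of the
  sets \<open>F i\<close>. The form is therefore a sum of squares, one for each point of
  \<open>V\<close>.\<close>

lemma quadratic_form_card_Int_nonneg: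
  fixes x :: "'i \<Rightarrow> real"
  assumes V: "finite V" and sub: "\<And>i. i \<in> I \<Longrightarrow> F i \<subseteq> V"
  shows "0 \<le> (\<Sum>i\<in>I. \<Sum>j\<in>I. real (card (F i \<inter> F j)) * x i * x j)"
proof -
  have card: "real (card (F i \<inter> F j)) = (\<Sum>v\<in>V. of_bool (v \<in> F i) * of_bool (v \<in> F j))"
    if "i \<in> I" for i j
  proof -
    have "V \<inter> {v. v \<in> F i \<and> v \<in> F j} = F i \<inter> F j"
      using sub[OF that] by blast
    then show ?thesis
      using V by (simp flip: of_bool_conj)
  qed
  have "(\<Sum>i\<in>I. \<Sum>j\<in>I. real (card (F i \<inter> F j)) * x i * x j)
      = (\<Sum>i\<in>I. \<Sum>j\<in>I. \<Sum>v\<in>V. (of_bool (v \<in> F i) * x i) * (of_bool (v \<in> F j) * x j))"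
    by (intro sum.cong refl) (simp add: card sum_distrib_left sum_distrib_right mult_ac)
  \<comment> \<open>The sum over \<open>v\<close> moves outermost: for fixed \<open>v\<close> the
    double sum over \<open>i\<close> and \<open>j\<close> factors as a square.\<close>
  also have "\<dots> = (\<Sum>i\<in>I. \<Sum>v\<in>V. \<Sum>j\<in>I. (of_bool (v \<in> F i) * x i) * (of_bool (v \<in> F j) * x j))"
    by (intro sum.cong refl sum.swap)
  also have "\<dots> = (\<Sum>v\<in>V. \<Sum>i\<in>I. \<Sum>j\<in>I. (of_bool (v \<in> F i) * x i) * (of_bool (v \<in> F j) * x j))"
    by (rule sum.swap)
  also have "\<dots> = (\<Sum>v\<in>V. (\<Sum>i\<in>I. of_bool (v \<in> F i) * x i)\<^sup>2)"
    by (simp only: power2_eq_square sum_product)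
  finally show ?thesis
    by (simp only: sum_nonneg zero_le_power2)
qed

text \<open>The argument works for any graph with loops on a finite vertex set: the vertices of its
  line graph are one- or two-element subsets of that set, and they may be enumerated in any
  order.\<close>

lemma eigenvalue_line_graph_ge:
  assumes V: "finite (verts H)" and sub: "\<And>e. e \<in> edges H \<Longrightarrow> e \<subseteq> verts H"
    and dist: "distinct es" and es: "set es = verts (line_graph H)"
    and ev: "eigenvalue (adjacency_matrix es (line_graph H)) k"
  shows "-2 \<le> k"
proof (rule eigenvalue_ge_if_quadratic_form_ge[OF _ ev])
  let ?A = "adjacency_matrix es (line_graph H)" and ?n = "length es"
  show "?A \<in> carrier_mat ?n ?n"
    by (simp add: adjacency_matrix_def)
  have mem: "es ! i \<in> ordinary_edges H \<union> loops H" if "i < ?n" for i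
    using nth_mem[OF that] by (simp add: es line_graph_def)
  \<comment> \<open>The diagonal of \<open>2 D\<close> in the order of \<open>es\<close>.\<close>
  define d where "d i = (if es ! i \<in> loops H then 2 else 0 :: real)" for i
  have entry: "?A $$ (i, j) = real (card (es ! i \<inter> es ! j)) + (if j = i then d i - 2 else 0)"
    if "i < ?n" "j < ?n" for i j
    using that adjacency_line_graph_eq_card_Int[OF mem[OF that(1)] mem[OF that(2)]] dist
    by (auto simp: adjacency_matrix_def d_def nth_eq_iff_index_eq)
  fix x :: "nat \<Rightarrow> real"
  have "(\<Sum>i<?n. \<Sum>j<?n. ?A $$ (i, j) * x i * x j) =
      (\<Sum>i<?n. \<Sum>j<?n. real (card (es ! i \<inter> es ! j)) * x i * x j
        + (if j = i then (d i - 2) * (x i)\<^sup>2 else 0))"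
    by (intro sum.cong refl) (simp add: entry power2_eq_square algebra_simps)
  also have "\<dots> = (\<Sum>i<?n. \<Sum>j<?n. real (card (es ! i \<inter> es ! j)) * x i * x j)
      + (\<Sum>i<?n. (d i - 2) * (x i)\<^sup>2)"
    by (simp add: sum.distrib)
  \<comment> \<open>The Gram part is nonnegative, and \<open>d i \<ge> 0\<close> bounds each
    diagonal coefficient below by -2.\<close>
  also have "\<dots> \<ge> 0 + (\<Sum>i<?n. -2 * (x i)\<^sup>2)"
  proof (intro add_mono sum_mono mult_right_mono quadratic_form_card_Int_nonneg[OF V])
    show "es ! i \<subseteq> verts H" if "i \<in> {..<?n}" for i
      using mem[of i] that sub by (auto simp: ordinary_edges_def loops_def)
  qed (simp_all add: d_def)
  finally show "-2 * (\<Sum>i<?n. (x i)\<^sup>2) \<le> (\<Sum>i<?n. \<Sum>j<?n. ?A $$ (i, j) * x i * x j)"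
    by (simp add: sum_distrib_left)
qed

theorem theorem2p6:
  fixes G :: "'a loop_graph" and S :: "'a set" and vs :: "'a set list" and \<mu> :: real
  assumes "simple_graph G"
    and "card (verts G) \<ge> 2"
    and "S \<subseteq> verts G"
    and "distinct vs" and "set vs = verts (line_graph (self_loop_graph G S))"
    and "eigenvalue (adjacency_matrix vs (line_graph (self_loop_graph G S))) \<mu>"
  shows "\<mu> \<ge> -2"
proof (rule eigenvalue_line_graph_ge[OF _ _ assms(4-6)])
  show "finite (verts (self_loop_graph G S))"
    using assms(1) by (simp add: simple_graph_def self_loop_graph_def)
  \<comment> \<open>For the loops this is where \<open>S \<subseteq> verts G\<close> enters.\<close>
  show "e \<subseteq> verts (self_loop_graph G S)" if "e \<in> edges (self_loop_graph G S)" for e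
    using that assms(1,3) by (auto simp: simple_graph_def self_loop_graph_def)
qed

end
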